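(* Let $a_0, b_0, c, d_0, f_0$ be complex numbers with $a_0 \neq 0$, and let $Q_0(x)$ be the unique formal power series satisfying $$Q_0(x) = \frac{a_0 + b_0 x}{1 + c x + d_0 x^2 + x^2(-1 + f_0 x)\,Q_0(x)}.$$ Put $f_1 = -\frac{b_0}{a_0}$ and $a_1 = a_0 - d_0 + \frac{b_0}{a_0}\left(c - \frac{b_0}{a_0}\right)$, and $$\alpha = a_0^2 (c + f_0 + f_1)^2, \qquad \beta = -(c+f_0+f_1)^2 a_0^3 - a_1\big((f_0 - f_1)(c + f_0 + f_1) - a_1\big) a_0^2 .$$ Then $\{H_n(Q_0)\}_{n \ge 0}$ is an $(\alpha,\beta)$ Somos 4 sequence, i.e. for all $n \ge 4$, $$H_n(Q_0)\, H_{n-4}(Q_0) = \alpha\, H_{n-1}(Q_0) H_{n-3}(Q_0) + \beta\, H_{n-2}(Q_0)^2 .$$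
   Context: For a formal power series $A(x) = \sum_{n\ge 0} a_n x^n$, its $n$-th Hankel determinant is $H_n(A) = \det\big(a_{i+j}\big)_{0 \le i,j \le n-1}$, with the convention $H_0(A) = 1$. A sequence $(s_n)$ is an $(\alpha,\beta)$ Somos 4 sequence if $s_n = \frac{\alpha s_{n-1}s_{n-3} + \beta s_{n-2}^2}{s_{n-4}}$ for all $n \ge 4$ (written here in the equivalent cleared-denominator form). *)

theory Defs
  imports
    "HOL-Computational_Algebra.Formal_Power_Series"
    "Jordan_Normal_Form.Determinant"
    Complex_Main
begin

definition hankel_det :: "nat \<Rightarrow> 'a :: comm_ring_1 fps \<Rightarrow> 'a" where
  "hankel_det n A = det (mat n n (\<lambda>(i, j). fps_nth A (i + j)))"

lemma hankel_det_0: "hankel_det 0 A = 1"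
  by (simp add: hankel_det_def)

definition somos4 :: "'a :: comm_ring_1 \<Rightarrow> 'a \<Rightarrow> (nat \<Rightarrow> 'a) \<Rightarrow> bool" where
  "somos4 \<alpha> \<beta> s \<longleftrightarrow>
     (\<forall>n\<ge>4. s n * s (n - 4) = \<alpha> * s (n - 1) * s (n - 3) + \<beta> * (s (n - 2))\<^sup>2)"

text \<open>
  The denominator has constant coefficient 1, hence is a unit, so the division below is
  multiplication by the inverse power series.
\<close>

definition Q_eqn ::
    "complex \<Rightarrow> complex \<Rightarrow> complex \<Rightarrow> complex \<Rightarrow> complex \<Rightarrow> complex fps \<Rightarrow> bool" where
  "Q_eqn a b c d f Q \<longleftrightarrow>
     Q = (fps_const a + fps_const b * fps_X) /
         (1 + fps_const c * fps_X + fps_const d * fps_X\<^sup>2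
            + fps_X\<^sup>2 * (- 1 + fps_const f * fps_X) * Q)"

lemma Q_eqn_iff:
  "Q_eqn a b c d f Q \<longleftrightarrow>
     Q * (1 + fps_const c * fps_X + fps_const d * fps_X\<^sup>2
            + fps_X\<^sup>2 * (- 1 + fps_const f * fps_X) * Q) = fps_const a + fps_const b * fps_X"
  (is "_ \<longleftrightarrow> Q * ?D = ?P")
proof -
  have D0: "fps_nth ?D 0 = 1" by simp
  hence u: "fps_nth ?D 0 \<noteq> 0" by simp
  have "X = P * inverse D \<longleftrightarrow> X * D = P" if "inverse D * D = 1" for X P D :: "complex fps"
  proof
    assume "X = P * inverse D"
    thus "X * D = P" by (simp only: mult.assoc that mult_1_right)
  next
    assume "X * D = P"
    hence "P * inverse D = X * (inverse D * D)" by (auto simp: mult_ac)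
    thus "X = P * inverse D" by (simp only: that mult_1_right)
  qed
  moreover have "inverse ?D * ?D = 1" using u by (rule inverse_mult_eq_1)
  moreover have "Q_eqn a b c d f Q \<longleftrightarrow> Q = ?P * inverse ?D"
    unfolding Q_eqn_def by (subst fps_divide_unit[OF u]) (rule refl)
  ultimately show ?thesis by (simp only:)
qed

lemma Q_eqn_ex1: "\<exists>!Q. Q_eqn a b c d f Q"
proof -
  define P D R :: "complex fps" where
    "P = fps_const a + fps_const b * fps_X" and
    "D = 1 + fps_const c * fps_X + fps_const d * fps_X\<^sup>2" and
    "R = fps_X\<^sup>2 * (- 1 + fps_const f * fps_X)"
  have iff: "Q_eqn a b c d f Q \<longleftrightarrow> Q * (D + R * Q) = P" for Q
    unfolding Q_eqn_iff P_def D_def R_def by (rule refl)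
  have D0: "fps_nth D 0 = 1" and R0: "fps_nth R 0 = 0"
    by (simp_all add: D_def R_def)
  define T where "T = D\<^sup>2 + 4 * R * P"
  have T0: "fps_nth T 0 = 1"
    by (simp add: T_def D0 R0 power2_eq_square)
  define S where "S = fps_radical (\<lambda>_ _. 1) 2 T"
  have S2: "S\<^sup>2 = T"
    using power_radical[of T "\<lambda>_ _. 1" 1] T0
    by (simp add: S_def numeral_2_eq_2)
  have S0: "fps_nth S 0 = 1"
    by (simp add: S_def)
  define U where "U = D + S"
  have U0: "fps_nth U 0 \<noteq> 0" by (simp add: U_def D0 S0)
  define Q where "Q = 2 * P * inverse U"
  have "Q * (D + R * Q) = P"
  proof -
    have i: "inverse U * U = 1" using U0 by (rule inverse_mult_eq_1)
    have "Q * U = 2 * P" by (simp add: Q_def mult.assoc i)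
    hence q: "U * Q = 2 * P" by (simp add: mult.commute)
    have s: "(U - D)\<^sup>2 = D\<^sup>2 + 4 * R * P" using S2 by (simp add: U_def T_def)
    have "U\<^sup>2 * (Q * (D + R * Q)) = U * D * (U * Q) + R * (U * Q) * (U * Q)"
      by (simp add: algebra_simps power2_eq_square)
    also have "\<dots> = P * (2 * U * D + 4 * R * P)"
      unfolding q by (simp add: algebra_simps)
    also have "4 * R * P = (U - D)\<^sup>2 - D\<^sup>2" using s by simp
    also have "2 * U * D + \<dots> = U\<^sup>2" by (simp add: algebra_simps power2_eq_square)
    finally have "U\<^sup>2 * (Q * (D + R * Q)) = U\<^sup>2 * P" by (simp add: mult.commute)
    moreover have "U \<noteq> 0" using U0 by auto
    ultimately show ?thesis by simp
  qed
  moreover have "Q' = Q''" if "Q' * (D + R * Q') = P" "Q'' * (D + R * Q'') = P" for Q' Q''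
  proof -
    have "(Q' - Q'') * (D + R * (Q' + Q'')) = Q' * (D + R * Q') - Q'' * (D + R * Q'')"
      by (simp add: algebra_simps)
    hence "(Q' - Q'') * (D + R * (Q' + Q'')) = 0"
      unfolding that by simp
    moreover have "fps_nth (D + R * (Q' + Q'')) 0 = 1" by (simp add: D0 R0)
    hence "D + R * (Q' + Q'') \<noteq> 0" by (metis fps_zero_nth zero_neq_one)
    ultimately show ?thesis by simp
  qed
  ultimately show ?thesis unfolding iff by (intro ex1I[of _ Q])
qed

end

theory Submission imports Defs begin

text \<open>
  Writing \<open>Q\<^sub>0 = a\<^sub>0 / (1 + (c + f\<^sub>1) x - x\<^sup>2 Q\<^sub>1)\<close>, the series \<open>Q\<^sub>1\<close> satisfies an equation of the same
  shape, with the same \<open>c\<close>, and \<open>H\<^sub>n\<^sub>+\<^sub>1(Q\<^sub>0) = a\<^sub>0\<^sup>n\<^sup>+\<^sup>1 H\<^sub>n(Q\<^sub>1)\<close>. As long as the leading coefficients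
  \<open>a\<^sub>0, a\<^sub>1, a\<^sub>2, \<dots>\<close> obtained by iteration do not vanish, \<open>a\<^sub>i (c + f\<^sub>i + f\<^sub>i\<^sub>+\<^sub>1)\<close> and \<open>\<beta>\<close> are invariants
  of the iteration, so the relation at \<open>n\<close> for \<open>Q\<^sub>0\<close> reduces to the one at \<open>n - 1\<close> for \<open>Q\<^sub>1\<close>, and
  ultimately to \<open>a\<^sub>0 a\<^sub>1\<^sup>2 a\<^sub>2 = \<alpha> a\<^sub>1 + \<beta>\<close>. If some Hankel determinant vanishes, move the parameters along
  the line towards \<open>(a\<^sub>0, b\<^sub>0, c, d\<^sub>0, f\<^sub>0) = (1, 0, 0, 0, 0)\<close>, where all Hankel determinants equal 1:
  they are polynomials on this line, hence nonzero off a finite set, and the relation extends by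
  continuity.
\<close>

section \<open>Hankel determinants of a reciprocal series\<close>

lemma hankel_det_1: "hankel_det (Suc 0) A = fps_nth A 0"
  by (simp add: hankel_det_def det_single)

lemma sum_nth_mult_eq_const:
  assumes "Q * R = fps_const a"
  shows "(\<Sum>m=0..j. fps_nth Q m * fps_nth R (j - m)) =
    (if j = 0 then a else (0 :: 'a :: comm_ring_1))"
  using arg_cong[OF assms, of "\<lambda>F. fps_nth F j"] by (simp add: fps_mult_nth)

text \<open>
  The entries of \<open>T H T\<^sup>t\<close>, where \<open>H\<close> is the Hankel matrix of \<open>Q\<close> and \<open>T\<close> the lower triangular Toeplitz
  matrix of \<open>R\<close>.
\<close>

lemma bezoutian_sum:
  fixes Q R :: "'a :: comm_ring_1 fps"
  assumes QR: "Q * R = fps_const a"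
  shows "(\<Sum>l=0..j. (\<Sum>k=0..i. fps_nth R (i - k) * fps_nth Q (k + l)) * fps_nth R (j - l))
       = (if i = 0 then a * fps_nth R j else 0) - (if j = 0 then 0 else a * fps_nth R (i + j))"
proof -
  \<comment> \<open>The left side is the tail \<open>m >= l\<close> of the convolution for
    coefficient \<open>i + l\<close> of \<open>Q * R\<close>, hence that coefficient minus the
    head.\<close>
  have conv: "(\<Sum>k=0..i. fps_nth R (i - k) * fps_nth Q (k + l)) = (if i + l = 0 then a else 0)
        - (\<Sum>m<l. fps_nth Q m * fps_nth R (i + l - m))" for l
  proof -
    have "(if i + l = 0 then a else 0) = (\<Sum>m=0..i+l. fps_nth Q m * fps_nth R (i + l - m))"
      using sum_nth_mult_eq_const[OF QR, of "i + l"] by simp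
    also have "{0..i+l} = {..<l} \<union> {l..i+l}" by auto
    also have "(\<Sum>m\<in>\<dots>. fps_nth Q m * fps_nth R (i + l - m)) =
      (\<Sum>m<l. fps_nth Q m * fps_nth R (i + l - m)) + (\<Sum>m=0+l..i+l. fps_nth Q m * fps_nth R (i + l - m))"
      by (subst sum.union_disjoint) auto
    also have "(\<Sum>m=0+l..i+l. fps_nth Q m * fps_nth R (i + l - m))
        = (\<Sum>k=0..i. fps_nth R (i - k) * fps_nth Q (k + l))"
      by (subst sum.shift_bounds_cl_nat_ivl) (simp add: mult.commute)
    finally show ?thesis by simp
  qed
  have "(\<Sum>l=0..j. (\<Sum>m<l. fps_nth Q m * fps_nth R (i + l - m)) * fps_nth R (j - l))
      = (\<Sum>(l,m)\<in>(SIGMA l:{0..j}. {..<l}). fps_nth Q m * fps_nth R (i + l - m) * fps_nth R (j - l))"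
    by (simp add: sum.Sigma sum_distrib_right)
  \<comment> \<open>Setting \<open>s = l - m\<close> separates \<open>R\<close> at
    \<open>i + s\<close> from an inner convolution for coefficient \<open>j - s\<close> of
    \<open>Q * R\<close>, which survives only at \<open>s = j\<close>.\<close>
  also have "\<dots> = (\<Sum>(s,m)\<in>(SIGMA s:{1..j}. {0..j - s}). fps_nth Q m * fps_nth R (j - s - m) * fps_nth R (i + s))"
    by (rule sum.reindex_bij_witness[of _ "\<lambda>(s,m). (s + m, m)" "\<lambda>(l,m). (l - m, m)"])
       (auto simp: algebra_simps)
  also have "\<dots> = (\<Sum>s=1..j. (\<Sum>m=0..j - s. fps_nth Q m * fps_nth R (j - s - m)) * fps_nth R (i + s))"
    by (simp add: sum.Sigma sum_distrib_right)
  also have "\<dots> = (\<Sum>s=1..j. if s = j then a * fps_nth R (i + j) else 0)"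
    by (intro sum.cong) (simp_all only: sum_nth_mult_eq_const[OF QR], auto)
  also have "\<dots> = (if j = 0 then 0 else a * fps_nth R (i + j))" by simp
  finally have second: "(\<Sum>l=0..j. (\<Sum>m<l. fps_nth Q m * fps_nth R (i + l - m)) * fps_nth R (j - l))
      = (if j = 0 then 0 else a * fps_nth R (i + j))" .
  have first: "(\<Sum>l=0..j. (if i + l = 0 then a else 0) * fps_nth R (j - l)) =
      (if i = 0 then a * fps_nth R j else 0)"
    by (cases "i = 0") (simp_all add: if_distrib[of "\<lambda>x. x * _"] sum.delta cong: if_cong)
  show ?thesis
    unfolding conv left_diff_distrib sum_subtractf first second ..
qed

text \<open>\<open>T\<close> is unitriangular, so \<open>T * M * transpose_mat T\<close> has the
  determinant of \<open>M\<close>. By \<open>bezoutian_sum\<close> its first row and column vanish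
  off the corner entry \<open>a\<close>, and the remaining block is \<open>a\<close> times the
  Hankel matrix of \<open>- fps_shift 2 R\<close>.\<close>

lemma hankel_det_continued_fraction:
  fixes Q R :: "'a :: idom fps"
  assumes QR: "Q * R = fps_const a" and R0: "fps_nth R 0 = 1"
  shows "hankel_det (Suc n) Q = a ^ Suc n * hankel_det n (- fps_shift 2 R)"
proof -
  define T where "T = mat (Suc n) (Suc n) (\<lambda>(i, j). if j \<le> i then fps_nth R (i - j) else 0)"
  define M where "M = mat (Suc n) (Suc n) (\<lambda>(i, j). fps_nth Q (i + j))"
  define M1 where "M1 = mat n n (\<lambda>(i, j). fps_nth (- fps_shift 2 R) (i + j))"
  define B where "B = four_block_mat (1\<^sub>m 1) (0\<^sub>m 1 n) (0\<^sub>m n 1) M1"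
  have [simp]: "T \<in> carrier_mat (Suc n) (Suc n)" "M \<in> carrier_mat (Suc n) (Suc n)"
    "M1 \<in> carrier_mat n n" "B \<in> carrier_mat (Suc n) (Suc n)"
    by (auto simp: T_def M_def M1_def B_def)
  have detT: "det T = 1"
  proof (subst det_lower_triangular[of "Suc n"])
    show "prod_list (diag_mat T) = 1"
      unfolding prod_list_diag_prod by (simp add: T_def R0)
  qed (auto simp: T_def)
  have TM: "(T * M) $$ (i, l) = (\<Sum>k=0..i. fps_nth R (i - k) * fps_nth Q (k + l))"
    if "i < Suc n" "l < Suc n" for i l
  proof -
    have "(T * M) $$ (i, l) = (\<Sum>k=0..<Suc n. (if k \<le> i then fps_nth R (i - k) else 0) * fps_nth Q (k + l))"
      using that by (simp add: T_def M_def scalar_prod_def del: sum.op_ivl_Suc)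
    also have "\<dots> = (\<Sum>k=0..i. fps_nth R (i - k) * fps_nth Q (k + l))"
      using that by (intro sum.mono_neutral_cong_right) auto
    finally show ?thesis .
  qed
  have "T * M * transpose_mat T = a \<cdot>\<^sub>m B"
  proof (rule eq_matI)
    fix i j assume "i < dim_row (a \<cdot>\<^sub>m B)" "j < dim_col (a \<cdot>\<^sub>m B)"
    hence ij: "i < Suc n" "j < Suc n" by (auto simp: B_def M1_def)
    have "(T * M * transpose_mat T) $$ (i, j) = (\<Sum>l=0..<Suc n. (T * M) $$ (i, l) * T $$ (j, l))"
      using ij by (simp add: scalar_prod_def T_def M_def del: sum.op_ivl_Suc index_mult_mat)
                  (simp add: scalar_prod_def del: sum.op_ivl_Suc)
    also have "\<dots> = (\<Sum>l=0..j. (T * M) $$ (i, l) * fps_nth R (j - l))"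
      using ij by (intro sum.mono_neutral_cong_right) (auto simp: T_def)
    also have "\<dots> = (\<Sum>l=0..j. (\<Sum>k=0..i. fps_nth R (i - k) * fps_nth Q (k + l)) * fps_nth R (j - l))"
      using ij by (intro sum.cong) (auto simp: TM)
    also have "\<dots> = (a \<cdot>\<^sub>m B) $$ (i, j)"
      unfolding bezoutian_sum[OF QR] using ij
      by (cases i; cases j) (auto simp: B_def M1_def R0)
    finally show "(T * M * transpose_mat T) $$ (i, j) = (a \<cdot>\<^sub>m B) $$ (i, j)" .
  qed (auto simp: T_def M_def B_def M1_def)
  hence "det (T * M * transpose_mat T) = a ^ Suc n * det B"
    by (simp add: B_def M1_def)
  moreover have "det (T * M * transpose_mat T) = det M"
  proof -
    have "det (T * M * transpose_mat T) = det (T * M) * det (transpose_mat T)"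
      by (rule det_mult[of _ "Suc n"]) (auto simp: T_def M_def)
    also have "\<dots> = det M"
      by (simp add: det_mult[of T "Suc n" M] det_transpose[of T "Suc n"] detT)
    finally show ?thesis .
  qed
  moreover have "det B = det M1"
    unfolding B_def by (subst det_four_block_mat_upper_right_zero[of _ 1 _ n]) auto
  ultimately show ?thesis
    by (simp add: hankel_det_def M_def M1_def)
qed


section \<open>One continued fraction step on the quadratic equation\<close>

lemma Q_eqn_nth_0: "Q_eqn a b c d f Q \<Longrightarrow> fps_nth Q 0 = a"
  unfolding Q_eqn_iff by (drule arg_cong[of _ _ "\<lambda>F. fps_nth F 0"]) simp

text \<open>The two sides differ by \<open>A * X\<^sup>2\<close> times the defect of the equation
  for \<open>S\<close>. The conclusion is the quadratic equation of \<open>A / R\<close> with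
  \<open>R\<^sup>2\<close> cleared.\<close>

lemma continued_fraction_identity:
  fixes X :: "'a :: comm_ring_1"
  assumes "S * (1 + C * X + (- D - 2 * F1 * (C + F1)) * X\<^sup>2 + X\<^sup>2 * (- 1 + F1 * X) * S)
         = A1 + (A1 * (C + F1) - A * (C + F0 + F1)) * X"
    and "A1 = A - D - F1 * (C + F1)"
    and "R = 1 + (C + F1) * X - X\<^sup>2 * S"
  shows "A * (1 + C * X + D * X\<^sup>2) * R + X\<^sup>2 * (- 1 + F0 * X) * A\<^sup>2
       = R\<^sup>2 * (A + - (A * F1) * X)"
proof -
  have "R\<^sup>2 * (A + - (A * F1) * X) - (A * (1 + C * X + D * X\<^sup>2) * R + X\<^sup>2 * (- 1 + F0 * X) * A\<^sup>2)
      = A * X\<^sup>2 * (A1 + (A1 * (C + F1) - A * (C + F0 + F1)) * X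
        - S * (1 + C * X + (- D - 2 * F1 * (C + F1)) * X\<^sup>2 + X\<^sup>2 * (- 1 + F1 * X) * S))"
    unfolding assms(2,3) by (simp add: algebra_simps power2_eq_square)
  thus ?thesis unfolding assms(1) by simp
qed

text \<open>The candidate \<open>a / R\<close> built from \<open>Q1\<close> solves the equation of
  \<open>Q\<close>, so uniqueness identifies them. The linear coefficient for \<open>Q1\<close> is
  written without dividing by \<open>a1\<close>, so \<open>a1 = 0\<close> is covered.\<close>

lemma hankel_det_Q_eqn_shift:
  assumes Q: "Q_eqn a (- (a * f1)) c d f0 Q"
    and a1: "a1 = a - d - f1 * (c + f1)"
    and Q1: "Q_eqn a1 (a1 * (c + f1) - a * (c + f0 + f1)) c (- d - 2 * f1 * (c + f1)) f1 Q1"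
  shows "hankel_det (Suc n) Q = a ^ Suc n * hankel_det n Q1"
proof -
  define R where "R = 1 + fps_const (c + f1) * fps_X - fps_X\<^sup>2 * Q1"
  define Q' where "Q' = fps_const a * inverse R"
  have R0: "fps_nth R 0 = 1" by (simp add: R_def)
  hence QR: "Q' * R = fps_const a"
    by (simp add: Q'_def mult.assoc inverse_mult_eq_1)
  let ?P = "1 + fps_const c * fps_X + fps_const d * fps_X\<^sup>2 :: complex fps"
  let ?V = "- 1 + fps_const f0 * fps_X :: complex fps"
  have two: "2 = fps_const (2 :: complex)" by (simp add: numeral_fps_const)
  have "R\<^sup>2 * (Q' * (?P + fps_X\<^sup>2 * ?V * Q'))
      = fps_const a * ?P * R + fps_X\<^sup>2 * ?V * (fps_const a)\<^sup>2"
    unfolding QR[symmetric] by (simp add: algebra_simps power2_eq_square)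
  also have "\<dots> = R\<^sup>2 * (fps_const a + - (fps_const a * fps_const f1) * fps_X)"
    by (rule continued_fraction_identity
          [where S = Q1 and ?F1.0 = "fps_const f1" and ?A1.0 = "fps_const a1"])
       (use Q1 in \<open>simp_all only: Q_eqn_iff R_def a1 two
          fps_const_add fps_const_sub fps_const_mult fps_const_neg\<close>)
  finally have "R\<^sup>2 * (Q' * (?P + fps_X\<^sup>2 * ?V * Q'))
      = R\<^sup>2 * (fps_const a + - (fps_const a * fps_const f1) * fps_X)" .
  moreover have "R \<noteq> 0" using R0 by auto
  ultimately have "Q' * (?P + fps_X\<^sup>2 * ?V * Q') = fps_const a + - (fps_const a * fps_const f1) * fps_X"
    by (metis mult_left_cancel power_not_zero)
  hence "Q_eqn a (- (a * f1)) c d f0 Q'"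
    by (simp only: Q_eqn_iff fps_const_mult fps_const_neg)
  hence "Q' = Q" using Q Q_eqn_ex1 by blast
  moreover have "- fps_shift 2 R = Q1"
    by (rule fps_ext) (simp add: R_def fps_X_power_mult_nth)
  ultimately show ?thesis
    using hankel_det_continued_fraction[OF QR R0] by simp
qed

lemma Q_eqn_shift:
  assumes Q: "Q_eqn a (- (a * f1)) c d f0 Q"
    and a1: "a1 = a - d - f1 * (c + f1)" "a1 \<noteq> 0"
  obtains f2 Q1 where
    "Q_eqn a1 (- (a1 * f2)) c (- d - 2 * f1 * (c + f1)) f1 Q1"
    "a1 * (c + f1 + f2) = a * (c + f0 + f1)"
    "\<And>n. hankel_det (Suc n) Q = a ^ Suc n * hankel_det n Q1"
proof -
  obtain Q1 where Q1: "Q_eqn a1 (a1 * (c + f1) - a * (c + f0 + f1)) c (- d - 2 * f1 * (c + f1)) f1 Q1"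
    using Q_eqn_ex1 by blast
  \<comment> \<open>Solves the invariance of \<open>a * (c + f0 + f1)\<close> for the next
    parameter, which restores the shape of the equation.\<close>
  define f2 where "f2 = a * (c + f0 + f1) / a1 - (c + f1)"
  have f2: "a1 * (c + f1 + f2) = a * (c + f0 + f1)"
    using a1(2) by (simp add: f2_def field_simps)
  hence "a1 * (c + f1) - a * (c + f0 + f1) = - (a1 * f2)"
    by (simp add: algebra_simps)
  thus ?thesis
    using that[OF _ f2 hankel_det_Q_eqn_shift[OF Q a1(1) Q1]] Q1 by simp
qed

text \<open>One shift reduces this to the constant coefficient of \<open>Q1\<close>. It turns
  nonvanishing Hankel determinants into the \<open>a1 \<noteq> 0\<close> that
  \<open>Q_eqn_shift\<close> requires.\<close>

lemma hankel_det_2_Q_eqn: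
  assumes Q: "Q_eqn a (- (a * f1)) c d f0 Q"
  shows "hankel_det 2 Q = a\<^sup>2 * (a - d - f1 * (c + f1))"
proof -
  define a1 where "a1 = a - d - f1 * (c + f1)"
  obtain Q1 where Q1: "Q_eqn a1 (a1 * (c + f1) - a * (c + f0 + f1)) c (- d - 2 * f1 * (c + f1)) f1 Q1"
    using Q_eqn_ex1 by blast
  from hankel_det_Q_eqn_shift[OF Q a1_def Q1, of 1] show ?thesis
    by (simp add: hankel_det_1 Q_eqn_nth_0[OF Q1] a1_def numeral_2_eq_2)
qed

section \<open>Invariants and the generic Somos relation\<close>

definition somos_beta :: "'a :: comm_ring_1 \<Rightarrow> 'a \<Rightarrow> 'a \<Rightarrow> 'a \<Rightarrow> 'a \<Rightarrow> 'a" where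
  "somos_beta a a1 c f0 f1 =
     - ((c + f0 + f1)\<^sup>2 * a ^ 3) - a1 * ((f0 - f1) * (c + f0 + f1) - a1) * a\<^sup>2"

lemma
  fixes a :: "'a :: comm_ring_1"
  assumes "a1 = a - d - f1 * (c + f1)"
    and "a2 = a1 - (- d - 2 * f1 * (c + f1)) - f2 * (c + f2)"
    and g: "a1 * (c + f1 + f2) = a * (c + f0 + f1)"
  shows somos_relation: "a * a1\<^sup>2 * a2 = a\<^sup>2 * (c + f0 + f1)\<^sup>2 * a1 + somos_beta a a1 c f0 f1"
    and somos_beta_shift: "somos_beta a1 a2 c f1 f2 = somos_beta a a1 c f0 f1"
proof -
  have a2: "a2 = a + f1 * (c + f1) - f2 * (c + f2)"
    unfolding assms by (simp add: algebra_simps)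
  show rel: "a * a1\<^sup>2 * a2 = a\<^sup>2 * (c + f0 + f1)\<^sup>2 * a1 + somos_beta a a1 c f0 f1"
  proof -
    have "a * a1\<^sup>2 * a2 - (a\<^sup>2 * (c + f0 + f1)\<^sup>2 * a1 + somos_beta a a1 c f0 f1)
        = (a1 * (c + f1 + f2) - a * (c + f0 + f1)) * (a * (a1 * (f1 - f2) - a * (c + f0 + f1)))"
      unfolding a2 somos_beta_def by (simp add: algebra_simps power2_eq_square power3_eq_cube)
    thus ?thesis unfolding g by simp
  qed
  \<comment> \<open>A second expansion of the same product, in the parameters one step later. Its
    first term agrees with that of \<open>rel\<close> by \<open>g\<close>, so the two values of
    \<open>somos_beta\<close> agree.\<close>
  have "a * a1\<^sup>2 * a2 = a1\<^sup>2 * (c + f1 + f2)\<^sup>2 * a1 + somos_beta a1 a2 c f1 f2"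
    unfolding a2 somos_beta_def by (simp add: algebra_simps power2_eq_square power3_eq_cube)
  with rel g show "somos_beta a1 a2 c f1 f2 = somos_beta a a1 c f0 f1"
    by (metis add_left_cancel power_mult_distrib)
qed

text \<open>The induction generalizes over the parameters; nonvanishing passes to \<open>Q1\<close>
  by the product formula and keeps each new leading coefficient nonzero.\<close>

lemma somos4_generic:
  assumes "4 \<le> n"
    and "a \<noteq> 0"
    and "Q_eqn a (- (a * f1)) c d f0 Q"
    and "a1 = a - d - f1 * (c + f1)"
    and "\<And>k. 0 < k \<Longrightarrow> k < n \<Longrightarrow> hankel_det k Q \<noteq> 0"
  shows "hankel_det n Q * hankel_det (n - 4) Q =
    a\<^sup>2 * (c + f0 + f1)\<^sup>2 * hankel_det (n - 1) Q * hankel_det (n - 3) Q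
    + somos_beta a a1 c f0 f1 * (hankel_det (n - 2) Q)\<^sup>2"
  using assms
proof (induction n arbitrary: a a1 d f0 f1 Q rule: nat_induct_at_least)
  case base
  note Q = base(2) and a1 = base(3)
  have a1_0: "a1 \<noteq> 0" using base(4)[of 2] hankel_det_2_Q_eqn[OF Q] a1 by auto
  obtain f2 Q1 where Q1: "Q_eqn a1 (- (a1 * f2)) c (- d - 2 * f1 * (c + f1)) f1 Q1"
    and g1: "a1 * (c + f1 + f2) = a * (c + f0 + f1)"
    and H: "\<And>n. hankel_det (Suc n) Q = a ^ Suc n * hankel_det n Q1"
    using Q_eqn_shift[OF Q a1 a1_0] by blast
  define a2 where "a2 = a1 - (- d - 2 * f1 * (c + f1)) - f2 * (c + f2)"
  have a2_0: "a2 \<noteq> 0"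
    using base(4)[of 3] hankel_det_2_Q_eqn[OF Q1] H[of 2] by (auto simp: a2_def numeral_3_eq_3)
  obtain f3 Q2 where Q2: "Q_eqn a2 (- (a2 * f3)) c (- (- d - 2 * f1 * (c + f1)) - 2 * f2 * (c + f2)) f2 Q2"
    and g2: "a2 * (c + f2 + f3) = a1 * (c + f1 + f2)"
    and H1: "\<And>n. hankel_det (Suc n) Q1 = a1 ^ Suc n * hankel_det n Q2"
    using Q_eqn_shift[OF Q1 a2_def a2_0] by blast
  define a3 where "a3 = a2 - (- (- d - 2 * f1 * (c + f1)) - 2 * f2 * (c + f2)) - f3 * (c + f3)"
  \<comment> \<open>After removing \<open>a ^ 4 * a1\<^sup>2\<close>, the case \<open>n = 4\<close>
    is \<open>somos_relation\<close> one level down, with both coefficients carried back by the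
    invariants.\<close>
  have rel: "a1 * a2\<^sup>2 * a3 = a\<^sup>2 * (c + f0 + f1)\<^sup>2 * a2 + somos_beta a a1 c f0 f1"
    using somos_relation[OF a2_def a3_def g2] somos_beta_shift[OF a1 a2_def g1] g1
    by (metis power_mult_distrib)
  have H2: "hankel_det 2 Q2 = a2\<^sup>2 * a3"
    using hankel_det_2_Q_eqn[OF Q2] by (simp add: a3_def)
  have "hankel_det 1 Q1 = a1" "hankel_det 1 Q2 = a2"
    by (simp_all add: hankel_det_1 Q_eqn_nth_0[OF Q1] Q_eqn_nth_0[OF Q2])
  hence vals: "hankel_det 1 Q = a" "hankel_det 2 Q = a\<^sup>2 * a1" "hankel_det 3 Q = a ^ 3 * (a1\<^sup>2 * a2)"
    "hankel_det 4 Q = a ^ 4 * (a1 ^ 3 * (a2\<^sup>2 * a3))"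
    using H[of 0] H[of 1] H[of 2] H[of 3] H1[of 1] H1[of 2] H2
    by (simp_all add: numeral_eq_Suc hankel_det_0)
  have "a ^ 4 * (a1 ^ 3 * (a2\<^sup>2 * a3)) = a ^ 4 * a1\<^sup>2 * (a1 * a2\<^sup>2 * a3)"
    by (simp add: power_numeral_reduce)
  also have "\<dots> = a\<^sup>2 * (c + f0 + f1)\<^sup>2 * (a ^ 3 * (a1\<^sup>2 * a2)) * a + somos_beta a a1 c f0 f1 * (a\<^sup>2 * a1)\<^sup>2"
    unfolding rel by (simp add: algebra_simps power_numeral_reduce)
  finally show ?case by (simp add: vals hankel_det_0 vals[unfolded One_nat_def])
next
  case (Suc n)
  note Q = Suc.prems(2) and a1 = Suc.prems(3)
  have a1_0: "a1 \<noteq> 0" using Suc.prems(4)[of 2] hankel_det_2_Q_eqn[OF Q] a1 Suc.hyps by auto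
  obtain f2 Q1 where Q1: "Q_eqn a1 (- (a1 * f2)) c (- d - 2 * f1 * (c + f1)) f1 Q1"
    and g1: "a1 * (c + f1 + f2) = a * (c + f0 + f1)"
    and H: "\<And>n. hankel_det (Suc n) Q = a ^ Suc n * hankel_det n Q1"
    using Q_eqn_shift[OF Q a1 a1_0] by blast
  define a2 where "a2 = a1 - (- d - 2 * f1 * (c + f1)) - f2 * (c + f2)"
  have nz: "hankel_det k Q1 \<noteq> 0" if "0 < k" "k < n" for k
    using Suc.prems(4)[of "Suc k"] H[of k] that by auto
  have g1': "a1\<^sup>2 * (c + f1 + f2)\<^sup>2 = a\<^sup>2 * (c + f0 + f1)\<^sup>2"
    using g1 by (metis power_mult_distrib)
  note IH = Suc.IH[OF a1_0 Q1 a2_def nz, unfolded g1' somos_beta_shift[OF a1 a2_def g1]]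
  obtain m where n: "n = Suc (Suc (Suc (Suc m)))"
    using that[of "n - 4"] Suc.hyps by simp
  \<comment> \<open>These are the powers of \<open>a\<close> split off by the shift. As 5 + 1 = 4 +
    2 = 3 + 3, all three terms of the relation share one common power.\<close>
  define p where "p j = a ^ (m + j)" for j
  have H_p: "hankel_det (Suc n - j) Q = p (5 - j) * hankel_det (n - j) Q1" if "j \<le> 4" for j
  proof -
    have "Suc n - j = Suc (n - j)" "m + (5 - j) = Suc (n - j)"
      using that n by simp_all
    thus ?thesis by (simp only: p_def H)
  qed
  have p: "p 5 * p 1 = p 4 * p 2" "(p 3)\<^sup>2 = p 4 * p 2"
    by (simp_all add: p_def power_add power2_eq_square numeral_eq_Suc mult_ac)
  have "hankel_det (Suc n) Q * hankel_det (Suc n - 4) Q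
      = (p 5 * p 1) * (hankel_det n Q1 * hankel_det (n - 4) Q1)"
    using H_p[of 0] H_p[of 4] by simp
  also have "\<dots> = a\<^sup>2 * (c + f0 + f1)\<^sup>2 * (p 4 * hankel_det (n - 1) Q1) * (p 2 * hankel_det (n - 3) Q1)
      + somos_beta a a1 c f0 f1 * (p 3 * hankel_det (n - 2) Q1)\<^sup>2"
    unfolding p(1) power_mult_distrib[of "p 3"] p(2) by (subst IH) (simp_all add: distrib_left mult_ac)
  finally show ?case
    using H_p[of 1] H_p[of 2] H_p[of 3] by simp
qed

section \<open>The base point and polynomial dependence on a parameter\<close>

text \<open>These parameters are fixed by the shift, so \<open>Q\<close> is its own successor; it is
  the Catalan series in \<open>x\<^sup>2\<close>.\<close>

lemma hankel_det_base_point: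
  assumes Q: "Q_eqn 1 0 0 0 0 Q"
  shows "hankel_det n Q = 1"
proof (induction n)
  case (Suc n)
  have "hankel_det (Suc n) Q = 1 ^ Suc n * hankel_det n Q"
    by (rule hankel_det_Q_eqn_shift[where ?a1.0 = 1 and c = 0 and d = 0 and ?f0.0 = 0 and ?f1.0 = 0])
       (use Q in simp_all)
  thus ?case using Suc by simp
qed (rule hankel_det_0)

definition polyfun :: "('a :: comm_ring_1 \<Rightarrow> 'a) \<Rightarrow> bool" where
  "polyfun h \<longleftrightarrow> (\<exists>p. \<forall>t. h t = poly p t)"

lemma polyfun_const: "polyfun (\<lambda>t. k)"
  unfolding polyfun_def by (rule exI[of _ "[:k:]"]) auto

lemma polyfun_ident: "polyfun (\<lambda>t. t)"
  unfolding polyfun_def by (rule exI[of _ "[:0, 1:]"]) auto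

lemma polyfun_add: "polyfun g \<Longrightarrow> polyfun h \<Longrightarrow> polyfun (\<lambda>t. g t + h t)"
  unfolding polyfun_def by (metis poly_add)

lemma polyfun_diff: "polyfun g \<Longrightarrow> polyfun h \<Longrightarrow> polyfun (\<lambda>t. g t - h t)"
  unfolding polyfun_def by (metis poly_diff)

lemma polyfun_mult: "polyfun g \<Longrightarrow> polyfun h \<Longrightarrow> polyfun (\<lambda>t. g t * h t)"
  unfolding polyfun_def by (metis poly_mult)

lemma polyfun_sum: "(\<And>i. i \<in> I \<Longrightarrow> polyfun (h i)) \<Longrightarrow> polyfun (\<lambda>t. \<Sum>i\<in>I. h i t)"
  by (induction I rule: infinite_finite_induct) (auto intro: polyfun_add polyfun_const)

lemma polyfun_prod: "(\<And>i. i \<in> I \<Longrightarrow> polyfun (h i)) \<Longrightarrow> polyfun (\<lambda>t. \<Prod>i\<in>I. h i t)"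
  by (induction I rule: infinite_finite_induct) (auto intro: polyfun_mult polyfun_const)

lemmas polyfun_intros =
  polyfun_const polyfun_ident polyfun_add polyfun_diff polyfun_mult polyfun_sum polyfun_prod

lemma polyfun_hankel_det:
  assumes "\<And>n. polyfun (\<lambda>t. fps_nth (Q t) n)"
  shows "polyfun (\<lambda>t. hankel_det n (Q t))"
proof -
  have "hankel_det n (Q t) =
      (\<Sum>p\<in>{p. p permutes {0..<n}}. signof p * (\<Prod>i=0..<n. fps_nth (Q t) (i + p i)))" for t
    unfolding hankel_det_def
    by (subst det_def'[of _ n])
       (auto intro!: sum.cong prod.cong simp: permutes_in_image[where S = "{0..<n}", simplified])
  thus ?thesis by (auto intro!: polyfun_intros assms)
qed

text \<open>Every term of the expanded equation that contains \<open>Q\<close>, other than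
  \<open>Q\<close> itself, carries a power of \<open>fps_X\<close>. Coefficients thus come from
  earlier ones without division, which makes them polynomial in the parameters.\<close>

lemma Q_eqn_nth:
  assumes "Q_eqn a b c d f Q"
  shows "fps_nth Q n = (if n = 0 then a else 0) + (if n = 1 then b else 0)
    - (if n < 1 then 0 else c * fps_nth Q (n - 1)) - (if n < 2 then 0 else d * fps_nth Q (n - 2))
    + (if n < 2 then 0 else \<Sum>i=0..n-2. fps_nth Q i * fps_nth Q (n - 2 - i))
    - (if n < 3 then 0 else f * (\<Sum>i=0..n-3. fps_nth Q i * fps_nth Q (n - 3 - i)))"
proof -
  have "Q = fps_const a + fps_const b * fps_X - fps_X ^ 1 * (fps_const c * Q)
      - fps_X ^ 2 * (fps_const d * Q) + fps_X ^ 2 * (Q * Q) - fps_X ^ 3 * (fps_const f * (Q * Q))"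
    unfolding assms[unfolded Q_eqn_iff, symmetric]
    by (simp add: algebra_simps power2_eq_square power3_eq_cube)
  hence "fps_nth Q n = fps_nth (fps_const a + fps_const b * fps_X - fps_X ^ 1 * (fps_const c * Q)
      - fps_X ^ 2 * (fps_const d * Q) + fps_X ^ 2 * (Q * Q) - fps_X ^ 3 * (fps_const f * (Q * Q))) n"
    by (rule arg_cong)
  thus ?thesis
    by (simp only: fps_add_nth fps_sub_nth fps_X_power_mult_nth fps_mult_left_const_nth fps_nth_fps_const
        fps_mult_right_const_nth fps_X_nth fps_mult_nth[of Q Q]) simp
qed

lemma polyfun_Q_eqn_nth:
  assumes Q: "\<And>t. Q_eqn (a t) (b t) (c t) (d t) (f t) (Q t)"
    and poly: "polyfun a" "polyfun b" "polyfun c" "polyfun d" "polyfun f"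
  shows "polyfun (\<lambda>t. fps_nth (Q t) n)"
proof (induction n rule: less_induct)
  case (less n)
  \<comment> \<open>The premise keeps the negated guard, which supplies the bound on
    \<open>n\<close> needed to apply the induction hypothesis.\<close>
  have zero: "polyfun (\<lambda>t. if P then 0 else h t)"
    if "\<not> P \<Longrightarrow> polyfun h" for P and h :: "complex \<Rightarrow> complex"
    using that by (cases P) (auto intro: polyfun_const)
  have zero': "polyfun (\<lambda>t. if P then h t else 0)"
    if "polyfun h" for P and h :: "complex \<Rightarrow> complex"
    using that by (cases P) (auto intro: polyfun_const)
  show ?case
    by (simp only: Q_eqn_nth[OF Q, where n = n], intro polyfun_intros zero zero' poly less.IH) auto
qed

section \<open>Extension by continuity\<close>

theorem theorem1:
  fixes a0 b0 c d0 f0 a1 f1 \<alpha> \<beta> :: complex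
    and Q :: "complex fps"
  assumes "a0 \<noteq> 0"
    and "Q_eqn a0 b0 c d0 f0 Q"
    and "f1 = - (b0 / a0)"
    and "a1 = a0 - d0 + b0 / a0 * (c - b0 / a0)"
    and "\<alpha> = a0\<^sup>2 * (c + f0 + f1)\<^sup>2"
    and "\<beta> = - ((c + f0 + f1)\<^sup>2 * a0 ^ 3) - a1 * ((f0 - f1) * (c + f0 + f1) - a1) * a0\<^sup>2"
  shows "somos4 \<alpha> \<beta> (\<lambda>n. hankel_det n Q)"
  unfolding somos4_def
proof (intro allI impI)
  fix n :: nat
  assume n: "4 \<le> n"
  define A where "A t = (1 - t) * a0 + t" for t
  define B where "B t = (1 - t) * b0" for t
  define C where "C t = (1 - t) * c" for t
  define D where "D t = (1 - t) * d0" for t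
  define F where "F t = (1 - t) * f0" for t
  \<comment> \<open>Only rational in \<open>t\<close>, hence the limit argument; it has no pole at 0
    because \<open>A 0 = a0\<close>.\<close>
  define F1 where "F1 t = - (B t / A t)" for t
  define A1 where "A1 t = A t - D t - F1 t * (C t + F1 t)" for t
  note defs = A_def B_def C_def D_def F_def
  have "\<forall>t. \<exists>Q. Q_eqn (A t) (B t) (C t) (D t) (F t) Q"
    using Q_eqn_ex1 by blast
  then obtain Qt where Qt: "\<And>t. Q_eqn (A t) (B t) (C t) (D t) (F t) (Qt t)"
    by metis
  have Qt_0: "Qt 0 = Q"
  proof -
    have "Q_eqn a0 b0 c d0 f0 (Qt 0)" using Qt[of 0] by (simp add: defs)
    thus ?thesis using assms(2) Q_eqn_ex1 by blast
  qed
  have "polyfun (\<lambda>t. hankel_det k (Qt t))" for k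
    by (intro polyfun_hankel_det polyfun_Q_eqn_nth[OF Qt]; unfold defs; intro polyfun_intros)
  then obtain h where h: "\<And>k t. hankel_det k (Qt t) = poly (h k) t"
    unfolding polyfun_def by metis
  have h_nz: "h k \<noteq> 0" for k
    using hankel_det_base_point[of "Qt 1" k] Qt[of 1] h[of k 1] by (auto simp: defs)
  \<comment> \<open>The indices are those required by \<open>somos4_generic\<close>;
    \<open>k = 1\<close> also excludes the zeros of \<open>A\<close>.\<close>
  define Z where "Z = (\<Union>k\<in>{0<..<n}. {t. poly (h k) t = 0})"
  define e where "e t = poly (h n) t * poly (h (n - 4)) t
    - ((A t)\<^sup>2 * (C t + F t + F1 t)\<^sup>2 * poly (h (n - 1)) t * poly (h (n - 3)) t
      + somos_beta (A t) (A1 t) (C t) (F t) (F1 t) * (poly (h (n - 2)) t)\<^sup>2)" for t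
  have e_0: "e t = 0" if "t \<notin> Z" for t
  proof -
    have nz: "hankel_det k (Qt t) \<noteq> 0" if "0 < k" "k < n" for k
      using \<open>t \<notin> Z\<close> that by (auto simp: Z_def h)
    have "A t \<noteq> 0"
      using nz[of 1] n by (simp add: hankel_det_1 Q_eqn_nth_0[OF Qt])
    moreover from this have "Q_eqn (A t) (- (A t * F1 t)) (C t) (D t) (F t) (Qt t)"
      using Qt by (simp add: F1_def)
    ultimately show ?thesis
      using somos4_generic[OF n _ _ A1_def nz] by (simp add: e_def h)
  qed
  have "finite Z"
    unfolding Z_def using h_nz by (auto intro: poly_roots_finite)
  \<comment> \<open>The point 0 may lie in \<open>Z\<close>, so the neighbourhood used is the
    complement of \<open>Z - {0}\<close>.\<close>
  hence "\<forall>\<^sub>F t in at 0. t \<notin> Z"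
    by (auto simp: eventually_at_topological intro!: exI[of _ "- (Z - {0})"] open_Compl finite_imp_closed)
  hence "(e \<longlongrightarrow> 0) (at 0)"
    by (intro tendsto_eventually) (auto elim: eventually_mono intro: e_0)
  moreover have "A 0 \<noteq> 0" using assms(1) by (simp add: A_def)
  hence "isCont e 0"
    unfolding e_def somos_beta_def A1_def F1_def defs by (intro continuous_intros) auto
  ultimately have "e 0 = 0"
    by (metis LIM_unique isCont_def)
  moreover have "F1 0 = f1" "A1 0 = a1"
    using assms by (simp_all add: F1_def A1_def defs algebra_simps)
  ultimately show "hankel_det n Q * hankel_det (n - 4) Q =
      \<alpha> * hankel_det (n - 1) Q * hankel_det (n - 3) Q + \<beta> * (hankel_det (n - 2) Q)\<^sup>2"
    using assms(5,6) h[of _ 0] by (simp add: e_def Qt_0 somos_beta_def defs)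
qed

end
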